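(* Consider the SCAD estimator $\hat\theta_{SCAD}$ with $\eta_n\to0$ and $n^{1/2}\eta_n\to\infty$. Let $\theta_n\in\mathbb{R}$ be such that $\theta_n/\eta_n\to\zeta$ for some $\zeta\in\mathbb{R}\cup\{-\infty,\infty\}$ and $n^{1/2}\theta_n\to\nu$ for some $\nu\in\mathbb{R}\cup\{-\infty,\infty\}$. [In case $\zeta\ne0$ the convergence of $n^{1/2}\theta_n$ already follows from that of $\theta_n/\eta_n$, and then $\nu=\mathrm{sign}(\zeta)\infty$.] 1. If $|\zeta|<a$, or if $|\zeta|=a$ and $n^{1/2}(a\eta_n-\mathrm{sign}(\zeta)\theta_n)\to\infty$, then $F_{SCAD,n,\theta_n}$ approaches pointmass at $-\nu$: in case $|\nu|<\infty$, $F_{SCAD,n,\theta_n}$ converges weakly to pointmass at $-\nu$; in case $|\nu|=\infty$, the total mass of $F_{SCAD,n,\theta_n}$ escapes to $-\nu$, in the sense that $F_{SCAD,n,\theta_n}(x)\to0$ for every $x\in\mathbb{R}$ if $-\nu=\infty$, and $F_{SCAD,n,\theta_n}(x)\to1$ for every $x\in\mathbb{R}$ if $-\nu=-\infty$. 2. If $|\zeta|=a$ and $n^{1/2}(a\eta_n-\mathrm{sign}(\zeta)\theta_n)\to r$ for some $r\in\mathbb{R}\cup\{-\infty\}$, then $F_{SCAD,n,\theta_n}(x)$ converges to $$\int_{-\infty}^{x}\left[\frac{a-2}{a-1}\,\phi\Big(\{(a-2)u+\mathrm{sign}(\zeta)r\}/(a-1)\Big)\boldsymbol{1}(\mathrm{sign}(\zeta)u\le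 r)+\phi(u)\,\boldsymbol{1}(\mathrm{sign}(\zeta)u>r)\right]du$$ for every $x\in\mathbb{R}$, with the convention that the integral over the first term is zero if $r=-\infty$. [In fact, convergence is in total variation distance.] 3. If $a<|\zeta|\le\infty$, then $F_{SCAD,n,\theta_n}$ converges weakly to the standard normal distribution $N(0,1)$. [In fact, convergence is in total variation distance.]
   Context: For each $n\ge1$ and $\theta\in\mathbb{R}$, $P_{n,\theta}$ is the probability measure under which $y_1,\dots,y_n$ are independent and each $N(\theta,1)$-distributed; $\bar y=n^{-1}\sum_{t=1}^n y_t$. $(\eta_n)$ is a sequence of positive real numbers and $a>2$ is a fixed constant. The SCAD estimator is $\hat\theta_{SCAD}=\mathrm{sign}(\bar y)(|\bar y|-\eta_n)_+$ if $|\bar y|\le 2\eta_n$, $\hat\theta_{SCAD}=\{(a-1)\bar y-\mathrm{sign}(\bar y)a\eta_n\}/(a-2)$ if $2\eta_n<|\bar y|\le a\eta_n$, and $\hat\theta_{SCAD}=\bar y$ if $|\bar y|>a\eta_n$, where $z_+=\max\{z,0\}$ and $\mathrm{sign}(x)=-1,0,1$ for $x<0$, $x=0$, $x>0$ (with $\mathrm{sign}(\pm\infty)=\pm1$). $F_{SCAD,n,\theta}$ denotes the distribution (and its cdf) of $n^{1/2}(\hat\theta_{SCAD}-\theta)$ under $P_{n,\theta}$. $\phi$ is the standard normal density; $\boldsymbol{1}(\cdot)$ is the indicator function. *)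

theory Defs
  imports "HOL-Probability.Probability"
begin

definition gauss_sample :: "nat \<Rightarrow> real \<Rightarrow> (nat \<Rightarrow> real) measure" where
  "gauss_sample n \<theta> = Pi\<^sub>M {1..n} (\<lambda>_. density lborel (\<lambda>x. ennreal (normal_density \<theta> 1 x)))"

definition sample_mean :: "nat \<Rightarrow> (nat \<Rightarrow> real) \<Rightarrow> real" where
  "sample_mean n y = (\<Sum>t=1..n. y t) / real n"

text \<open>The SCAD estimator as a function of the value \<open>m\<close> of the sample mean.\<close>

definition scad :: "real \<Rightarrow> real \<Rightarrow> real \<Rightarrow> real" where
  "scad a \<eta> m =
     (if \<bar>m\<bar> \<le> 2 * \<eta> then sgn m * max (\<bar>m\<bar> - \<eta>) 0
      else if \<bar>m\<bar> \<le> a * \<eta> then ((a - 1) * m - sgn m * a * \<eta>) / (a - 2)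
      else m)"

text \<open>The law of the centred and scaled estimator; its cdf is \<^term>\<open>cdf (scad_dist a \<eta> n \<theta>)\<close>.\<close>

definition scad_dist :: "real \<Rightarrow> real \<Rightarrow> nat \<Rightarrow> real \<Rightarrow> real measure" where
  "scad_dist a \<eta> n \<theta> =
     distr (gauss_sample n \<theta>) borel (\<lambda>y. sqrt (real n) * (scad a \<eta> (sample_mean n y) - \<theta>))"

text \<open>
  The limiting density, with \<open>s\<close> the sign of the limit of \<open>\<theta>\<^sub>n / \<eta>\<^sub>n\<close>.
  For \<open>r = -\<infinity>\<close> the first indicator vanishes identically, so the junk value
  \<^term>\<open>real_of_ereal (-\<infinity>)\<close> plays no role.
\<close>

definition scad_limit_density :: "real \<Rightarrow> real \<Rightarrow> ereal \<Rightarrow> real \<Rightarrow> real" where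
  "scad_limit_density a s r u =
     (a - 2) / (a - 1) * std_normal_density (((a - 2) * u + s * real_of_ereal r) / (a - 1))
       * indicator {u. ereal (s * u) \<le> r} u
     + std_normal_density u * indicator {u. r < ereal (s * u)} u"

text \<open>Meant for finite measures with the same measurable sets; the supremum is then bounded.\<close>

definition tv_dist :: "'a measure \<Rightarrow> 'a measure \<Rightarrow> real" where
  "tv_dist M N = (SUP A\<in>sets M. \<bar>measure M A - measure N A\<bar>)"

lemma real_distribution_scad_dist: "real_distribution (scad_dist a \<eta> n \<theta>)"
proof -
  interpret G: prob_space "gauss_sample n \<theta>"
    unfolding gauss_sample_def by (intro prob_space_PiM prob_space_normal_density) simp
  have [measurable]: "(\<lambda>y. y t) \<in> borel_measurable (gauss_sample n \<theta>)" if "t \<in> {1..n}" for t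
    using measurable_component_singleton[OF that,
        of "\<lambda>_. density lborel (\<lambda>x. ennreal (normal_density \<theta> 1 x))"]
    by (simp add: gauss_sample_def cong: measurable_cong_sets)
  have [measurable]: "sample_mean n \<in> borel_measurable (gauss_sample n \<theta>)"
    unfolding sample_mean_def[abs_def] by measurable
  have [measurable]: "(\<lambda>m. sgn m :: real) \<in> borel_measurable borel"
    by (simp add: sgn_real_def)
  have [measurable]: "scad a \<eta> \<in> borel_measurable borel"
    unfolding scad_def[abs_def] by measurable
  have "(\<lambda>y. sqrt (real n) * (scad a \<eta> (sample_mean n y) - \<theta>)) \<in> borel_measurable (gauss_sample n \<theta>)"
    by measurable
  then show ?thesis
    unfolding scad_dist_def by (rule G.real_distribution_distr)
qed

end

theory Submission
  imports Defs
begin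

text \<open>
  With \<open>\<alpha> = n\<^sup>1\<^sup>/\<^sup>2 \<eta>\<^sub>n\<close> and \<open>\<beta> = n\<^sup>1\<^sup>/\<^sup>2 \<theta>\<^sub>n\<close>, the centred and scaled estimator is
  \<open>T\<^sub>n(Z) = scad a \<alpha> (Z + \<beta>) - \<beta>\<close> for a standard normal \<open>Z\<close>, so everything follows from the
  pointwise behaviour of \<open>T\<^sub>n\<close>. In case 1, \<open>T\<^sub>n(z)\<close> tends to \<open>-\<nu>\<close> for each \<open>z\<close>. Cases 2 and 3 are one
  statement, case 3 being \<open>r = -\<infinity>\<close>: for each \<open>z\<close>, \<open>T\<^sub>n(z)\<close> eventually agrees with a map that depends
  only on \<open>\<gamma>\<^sub>n = a \<alpha> - s \<beta> \<longlonglongrightarrow> r\<close> and pushes the normal law forward to the limiting density with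
  parameter \<open>\<gamma>\<^sub>n\<close>; these densities converge almost everywhere, hence in \<open>L\<^sup>1\<close> by Scheffe's lemma.
\<close>

section \<open>Homogeneity and oddness of the SCAD map\<close>

lemma scad_measurable [measurable]: "scad a \<eta> \<in> borel_measurable borel"
proof -
  have [measurable]: "(\<lambda>m. sgn m :: real) \<in> borel_measurable borel"
    by (simp add: sgn_real_def)
  show ?thesis
    unfolding scad_def[abs_def] by measurable
qed

text \<open>Both thresholds and every branch are homogeneous of degree one in \<open>\<eta>\<close>
  and \<open>m\<close> jointly, so the factor n^(1/2) can be moved inside the estimator.\<close>

lemma scad_scale:
  assumes "c > 0"
  shows "c * scad a \<eta> m = scad a (c * \<eta>) (c * m)"
proof -
  have *: "\<bar>c * m\<bar> = c * \<bar>m\<bar>" "sgn (c * m) = sgn m"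
    using assms by (auto simp: abs_mult sgn_mult)
  have "\<bar>c * m\<bar> \<le> 2 * (c * \<eta>) \<longleftrightarrow> \<bar>m\<bar> \<le> 2 * \<eta>" "\<bar>c * m\<bar> \<le> a * (c * \<eta>) \<longleftrightarrow> \<bar>m\<bar> \<le> a * \<eta>"
    using assms mult_le_cancel_left_pos[of c "\<bar>m\<bar>"] unfolding *
    by (simp_all add: mult.left_commute)
  moreover have "max (\<bar>c * m\<bar> - c * \<eta>) 0 = c * max (\<bar>m\<bar> - \<eta>) 0"
    using assms by (simp add: * max_mult_distrib_left algebra_simps)
  moreover have "((a - 1) * (c * m) - sgn m * a * (c * \<eta>)) / (a - 2) =
      c * (((a - 1) * m - sgn m * a * \<eta>) / (a - 2))"
    by (simp add: algebra_simps)
  ultimately show ?thesis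
    by (simp add: scad_def * del: times_divide_eq_right)
qed

lemma scad_minus: "scad a \<eta> (- m) = - scad a \<eta> m"
  by (simp add: scad_def sgn_minus diff_divide_distrib add_divide_distrib minus_divide_left)

lemma scad_sgn_mult: "s \<in> {1, -1} \<Longrightarrow> scad a \<eta> (s * m) = s * scad a \<eta> m"
  by (auto simp: scad_minus)

section \<open>Reduction to a single standard normal variable\<close>

lemma prob_space_gauss_sample: "prob_space (gauss_sample n \<theta>)"
  unfolding gauss_sample_def by (intro prob_space_PiM prob_space_normal_density) simp

text \<open>The coordinates are independent N(\<theta>,1) variables, so their sum is N(n\<theta>,n);
  centring it and dividing by its standard deviation gives N(0,1).\<close>

lemma distributed_sample_mean:
  assumes "n \<ge> 1"
  shows "distributed (gauss_sample n \<theta>) lborel (\<lambda>y. sqrt (real n) * (sample_mean n y - \<theta>)) std_normal_density"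
proof -
  let ?D = "density lborel (\<lambda>x. ennreal (normal_density \<theta> 1 x))"
  interpret prob_space "gauss_sample n \<theta>"
    by (rule prob_space_gauss_sample)
  have meas[measurable]: "(\<lambda>y. y t) \<in> borel_measurable (gauss_sample n \<theta>)" if "t \<in> {1..n}" for t
    using measurable_component_singleton[OF that, of "\<lambda>_. ?D"]
    by (simp add: gauss_sample_def cong: measurable_cong_sets)
  have comp: "distr (gauss_sample n \<theta>) borel (\<lambda>y. y t) = ?D" if "t \<in> {1..n}" for t
    using distr_PiM_component[of "{1..n}" "\<lambda>_. ?D" t] that prob_space_normal_density[of 1 \<theta>]
    unfolding gauss_sample_def
    by (auto cong: distr_cong)
  \<comment> \<open>Restriction to the index set is the identity on the extensional functions of the
    product space, so the joint law of the coordinates is the product of their marginals.\<close>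
  have "distr (gauss_sample n \<theta>) (\<Pi>\<^sub>M t\<in>{1..n}. borel) (\<lambda>y. \<lambda>t\<in>{1..n}. y t) =
      distr (gauss_sample n \<theta>) (gauss_sample n \<theta>) (\<lambda>y. y)"
    unfolding gauss_sample_def
    by (intro distr_cong sets_PiM_cong refl) (auto simp: space_PiM extensional_restrict PiE_def)
  also have "\<dots> = (\<Pi>\<^sub>M t\<in>{1..n}. distr (gauss_sample n \<theta>) borel (\<lambda>y. y t))"
    unfolding distr_id by (subst gauss_sample_def, intro PiM_cong) (auto simp: comp)
  finally have indep: "indep_vars (\<lambda>_. borel) (\<lambda>t y. y t) {1..n}"
    using assms by (subst indep_vars_iff_distr_eq_PiM') (auto intro: meas)
  have dist: "distributed (gauss_sample n \<theta>) lborel (\<lambda>y. y t) (normal_density \<theta> 1)" if "t \<in> {1..n}" for t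
    using comp[OF that] meas[OF that] by (simp add: distributed_def cong: distr_cong)
  have "distributed (gauss_sample n \<theta>) lborel (\<lambda>y. \<Sum>t=1..n. y t)
      (normal_density (\<Sum>t=1..n. \<theta>) (sqrt (\<Sum>t=1..n. 1\<^sup>2)))"
    using assms by (intro sum_indep_normal indep dist) auto
  then have "distributed (gauss_sample n \<theta>) lborel (\<lambda>y. ((\<Sum>t=1..n. y t) - n * \<theta>) / sqrt n) std_normal_density"
    using assms by (subst normal_standard_normal_convert[symmetric]) auto
  also have "(\<lambda>y. ((\<Sum>t=1..n. y t) - n * \<theta>) / sqrt n) = (\<lambda>y. sqrt n * (sample_mean n y - \<theta>))"
    using assms by (auto simp: sample_mean_def field_simps)
  finally show ?thesis .
qed

text \<open>The laws for all n become images of one fixed probability measure, so the maps can be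
  compared at each fixed \<open>z\<close> as n grows.\<close>

lemma scad_dist_eq:
  assumes "n \<ge> 1"
  shows "scad_dist a \<eta> n \<theta> = distr std_normal_distribution borel
    (\<lambda>z. scad a (sqrt n * \<eta>) (z + sqrt n * \<theta>) - sqrt n * \<theta>)"
proof -
  let ?Z = "\<lambda>y. sqrt n * (sample_mean n y - \<theta>)"
  let ?T = "\<lambda>z. scad a (sqrt n * \<eta>) (z + sqrt n * \<theta>) - sqrt n * \<theta>"
  have Z: "distributed (gauss_sample n \<theta>) lborel ?Z std_normal_density"
    by (rule distributed_sample_mean[OF assms])
  have [measurable]: "?Z \<in> borel_measurable (gauss_sample n \<theta>)"
    using distributed_measurable[OF Z] by simp
  have "(\<lambda>y. sqrt n * (scad a \<eta> (sample_mean n y) - \<theta>)) = (\<lambda>y. ?T (?Z y))"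
    using assms by (auto simp: scad_scale algebra_simps)
  then have "scad_dist a \<eta> n \<theta> = distr (gauss_sample n \<theta>) borel (\<lambda>y. ?T (?Z y))"
    by (simp add: scad_dist_def)
  also have "\<dots> = distr (distr (gauss_sample n \<theta>) lborel ?Z) borel ?T"
    by (subst distr_distr) (auto simp: comp_def)
  also have "distr (gauss_sample n \<theta>) lborel ?Z = std_normal_distribution"
    by (rule distributed_distr_eq_density[OF Z])
  finally show ?thesis .
qed

text \<open>Dominated convergence for indicators, with the constant 1 as bound. It turns eventual
  agreement at each point into convergence of probabilities.\<close>

lemma (in prob_space) tendsto_measure_pointwise:
  assumes [measurable]: "\<And>n. A n \<in> sets M" "B \<in> sets M"
    and ev: "\<And>x. x \<in> space M \<Longrightarrow> eventually (\<lambda>n. x \<in> A n \<longleftrightarrow> x \<in> B) sequentially"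
  shows "(\<lambda>n. measure M (A n)) \<longlonglongrightarrow> measure M B"
proof -
  have "(\<lambda>n. \<integral>x. indicator (A n) x \<partial>M) \<longlonglongrightarrow> (\<integral>x. indicator B x \<partial>M :: real)"
  proof (rule integral_dominated_convergence[where w = "\<lambda>_. 1"])
    show "AE x in M. (\<lambda>n. indicator (A n) x :: real) \<longlonglongrightarrow> indicator B x"
    proof (rule AE_I2)
      fix x assume "x \<in> space M"
      from ev[OF this] show "(\<lambda>n. indicator (A n) x :: real) \<longlonglongrightarrow> indicator B x"
        by (rule tendsto_eventually[OF eventually_mono]) (auto simp: indicator_def)
    qed
  qed auto
  moreover have "A n \<inter> space M = A n" "B \<inter> space M = B" for n
    using sets.sets_into_space[of "A n" M] sets.sets_into_space[of B M] by auto
  ultimately show ?thesis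
    by simp
qed

section \<open>Total variation distance\<close>

lemma tv_dist_le:
  assumes "\<And>A. A \<in> sets M \<Longrightarrow> \<bar>measure M A - measure N A\<bar> \<le> B"
  shows "tv_dist M N \<le> B"
  unfolding tv_dist_def using assms by (intro cSUP_least) auto

text \<open>Differences of probabilities are at most 1, so the real supremum in
  \<open>tv_dist\<close> is taken over a bounded set and is a genuine upper bound.\<close>

lemma abs_measure_diff_le_tv_dist:
  assumes "prob_space M" "prob_space N" "A \<in> sets M"
  shows "\<bar>measure M A - measure N A\<bar> \<le> tv_dist M N"
proof -
  interpret M: prob_space M by fact
  interpret N: prob_space N by fact
  have "\<bar>measure M A - measure N A\<bar> \<le> 1" for A
    using M.prob_le_1[of A] N.prob_le_1[of A] measure_nonneg[of M A] measure_nonneg[of N A]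
    by linarith
  then show ?thesis
    unfolding tv_dist_def using assms(3) by (intro cSUP_upper) (auto intro!: bdd_aboveI[where M = 1])
qed

lemma tv_dist_nonneg:
  assumes "prob_space M" "prob_space N"
  shows "tv_dist M N \<ge> 0"
  using abs_measure_diff_le_tv_dist[OF assms sets.empty_sets] by simp

text \<open>The supremum ranges over the sets of the first argument, which is why \<open>M\<close>
  and \<open>N\<close> must have the same measurable sets.\<close>

lemma tv_dist_triangle:
  assumes "prob_space M" "prob_space N" "prob_space P" "sets M = sets N"
  shows "tv_dist M P \<le> tv_dist M N + tv_dist N P"
proof (rule tv_dist_le)
  fix A assume "A \<in> sets M"
  with assms show "\<bar>measure M A - measure P A\<bar> \<le> tv_dist M N + tv_dist N P"
    using abs_measure_diff_le_tv_dist[of M N A] abs_measure_diff_le_tv_dist[of N P A] by auto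
qed

text \<open>The coupling inequality: the events that \<open>X\<close> and \<open>Y\<close> lie in a
  given set can differ only where \<open>X\<close> and \<open>Y\<close> differ.\<close>

lemma (in prob_space) tv_dist_distr_le:
  fixes X Y :: "'a \<Rightarrow> real"
  assumes [measurable]: "X \<in> borel_measurable M" "Y \<in> borel_measurable M"
  shows "tv_dist (distr M borel X) (distr M borel Y) \<le> measure M {x \<in> space M. X x \<noteq> Y x}"
proof (rule tv_dist_le)
  fix A assume "A \<in> sets (distr M borel X)"
  then have [measurable]: "A \<in> sets borel" by simp
  let ?P = "X -` A \<inter> space M" and ?Q = "Y -` A \<inter> space M" and ?D = "{x \<in> space M. X x \<noteq> Y x}"
  have "measure M ?P \<le> measure M (?Q \<union> ?D)" "measure M ?Q \<le> measure M (?P \<union> ?D)"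
    by (auto intro!: finite_measure_mono)
  moreover have "measure M (?Q \<union> ?D) \<le> measure M ?Q + measure M ?D"
      "measure M (?P \<union> ?D) \<le> measure M ?P + measure M ?D"
    by (auto intro!: measure_Un_le)
  ultimately show "\<bar>measure (distr M borel X) A - measure (distr M borel Y) A\<bar> \<le> measure M ?D"
    by (simp add: measure_distr)
qed

lemma measure_density_eq_integral:
  fixes f :: "'a \<Rightarrow> real"
  assumes f: "integrable M f" "\<And>x. f x \<ge> 0" and A: "A \<in> sets M"
  shows "measure (density M f) A = (LINT x:A|M. f x)"
proof -
  have [measurable]: "f \<in> borel_measurable M" using f by simp
  have int: "integrable M (\<lambda>x. indicator A x * f x)"
    using integrable_mult_indicator[OF A f(1)] by simp
  have "emeasure (density M f) A = (\<integral>\<^sup>+x. ennreal (indicator A x * f x) \<partial>M)"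
    using A by (subst emeasure_density) (auto intro!: nn_integral_cong simp: indicator_def)
  also have "\<dots> = ennreal (LINT x:A|M. f x)"
    unfolding set_lebesgue_integral_def
    using f int by (subst nn_integral_eq_integral) auto
  finally show ?thesis
    using f by (simp add: measure_def set_lebesgue_integral_def integral_nonneg_AE)
qed

lemma tv_dist_density_le:
  fixes f g :: "'a \<Rightarrow> real"
  assumes f: "integrable M f" "\<And>x. f x \<ge> 0" and g: "integrable M g" "\<And>x. g x \<ge> 0"
  shows "tv_dist (density M f) (density M g) \<le> (\<integral>x. norm (f x - g x) \<partial>M)"
proof (rule tv_dist_le)
  fix A assume "A \<in> sets (density M f)"
  then have A: "A \<in> sets M" by simp
  have "measure (density M f) A - measure (density M g) A = (\<integral>x. indicator A x *\<^sub>R (f x - g x) \<partial>M)"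
    using integrable_mult_indicator[OF A f(1)] integrable_mult_indicator[OF A g(1)] f g A
    by (simp add: measure_density_eq_integral set_lebesgue_integral_def right_diff_distrib)
  also have "\<bar>\<dots>\<bar> \<le> (\<integral>x. norm (indicator A x *\<^sub>R (f x - g x)) \<partial>M)"
    using integral_norm_bound[of M "\<lambda>x. indicator A x *\<^sub>R (f x - g x)"] by simp
  also have "\<dots> \<le> (\<integral>x. norm (f x - g x) \<partial>M)"
    using f g A by (intro integral_mono integrable_norm integrable_mult_indicator)
      (auto simp: indicator_def)
  finally show "\<bar>measure (density M f) A - measure (density M g) A\<bar> \<le> (\<integral>x. norm (f x - g x) \<partial>M)" .
qed

text \<open>Since all total masses equal 1, Scheffe's lemma upgrades almost everywhere convergence
  to convergence in L1, which dominates total variation.\<close>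

lemma tv_dist_density_tendsto_0:
  fixes f :: "nat \<Rightarrow> 'a \<Rightarrow> real"
  assumes [measurable]: "\<And>n. f n \<in> borel_measurable M" "g \<in> borel_measurable M"
    and nonneg: "\<And>n x. f n x \<ge> 0" "\<And>x. g x \<ge> 0"
    and one: "\<And>n. (\<integral>\<^sup>+x. f n x \<partial>M) = 1" "(\<integral>\<^sup>+x. g x \<partial>M) = 1"
    and lim: "AE x in M. (\<lambda>n. f n x) \<longlonglongrightarrow> g x"
  shows "(\<lambda>n. tv_dist (density M (f n)) (density M g)) \<longlonglongrightarrow> 0"
proof -
  have intf: "integrable M (f n)" for n
    using one nonneg by (auto simp: integrable_iff_bounded)
  have intg: "integrable M g"
    using one nonneg by (auto simp: integrable_iff_bounded)
  have "(\<lambda>n. \<integral>\<^sup>+x. norm (f n x - g x) \<partial>M) \<longlonglongrightarrow> 0"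
    using intg lim one nonneg by (intro Scheffe_lemma2) auto
  moreover have "(\<integral>\<^sup>+x. norm (f n x - g x) \<partial>M) = ennreal (\<integral>x. norm (f n x - g x) \<partial>M)" for n
    using intf intg by (intro nn_integral_eq_integral) auto
  ultimately have lim_int: "(\<lambda>n. \<integral>x. norm (f n x - g x) \<partial>M) \<longlonglongrightarrow> 0"
    by (intro tendsto_ennrealD) auto
  have "prob_space (density M (f n))" "prob_space (density M g)" for n
    using one by (auto intro!: prob_spaceI simp: emeasure_density)
  then have "0 \<le> tv_dist (density M (f n)) (density M g)" for n
    by (rule tv_dist_nonneg)
  moreover have "tv_dist (density M (f n)) (density M g) \<le> (\<integral>x. norm (f n x - g x) \<partial>M)" for n
    by (rule tv_dist_density_le[OF intf nonneg(1) intg nonneg(2)])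
  ultimately show ?thesis
    by (intro real_tendsto_sandwich[OF _ _ tendsto_const[of 0] lim_int] always_eventually allI)
qed

text \<open>
  For \<open>s (z + \<beta>) > 2 \<alpha>\<close> the soft-thresholding branch is not active, and
  \<open>z \<mapsto> scad a \<alpha> (z + \<beta>) - \<beta>\<close> depends on \<open>\<alpha>\<close> and \<open>\<beta>\<close> only through \<open>\<gamma> = a \<alpha> - s \<beta>\<close>.
\<close>

definition scad_limit_map :: "real \<Rightarrow> real \<Rightarrow> real \<Rightarrow> real \<Rightarrow> real" where
  "scad_limit_map a s \<gamma> z = (if s * z \<le> \<gamma> then ((a - 1) * z - s * \<gamma>) / (a - 2) else z)"

section \<open>The limit map and the limiting density\<close>

lemma scad_limit_map_measurable [measurable]: "scad_limit_map a s \<gamma> \<in> borel_measurable borel"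
  unfolding scad_limit_map_def[abs_def] by measurable

lemma scad_limit_density_measurable [measurable]: "scad_limit_density a s r \<in> borel_measurable borel"
  unfolding scad_limit_density_def[abs_def] by measurable

lemma scad_limit_density_nonneg: "a > 2 \<Longrightarrow> scad_limit_density a s r u \<ge> 0"
  by (simp add: scad_limit_density_def)

lemma scad_limit_density_MInfty: "scad_limit_density a s (-\<infinity>) = std_normal_density"
  by (simp add: scad_limit_density_def fun_eq_iff)

text \<open>The last assumption forces \<open>z + \<beta>\<close> to have sign \<open>s\<close> and
  modulus above \<open>2 * \<alpha>\<close>; the remaining threshold
  \<open>s * (z + \<beta>) \<le> a * \<alpha>\<close> then reads
  \<open>s * z \<le> \<gamma>\<close>.\<close>

lemma scad_eq_scad_limit_map:
  assumes "a > 2" "s \<in> {1, -1}" "\<alpha> > 0" "s * (z + \<beta>) > 2 * \<alpha>"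
  shows "scad a \<alpha> (z + \<beta>) - \<beta> = scad_limit_map a s (a * \<alpha> - s * \<beta>) z"
proof (cases "s = 1")
  case True
  with assms have "sgn (z + \<beta>) = 1" "\<bar>z + \<beta>\<bar> = z + \<beta>" by auto
  with True assms show ?thesis
    by (auto simp: scad_def scad_limit_map_def field_simps)
next
  case False
  with assms have "s = -1" by simp
  with assms have "sgn (z + \<beta>) = -1" "\<bar>z + \<beta>\<bar> = - z - \<beta>" by auto
  with \<open>s = -1\<close> assms show ?thesis
    by (auto simp: scad_def scad_limit_map_def field_simps)
qed

text \<open>A change of variables on the affine branch. That branch is increasing and fixes the
  point \<open>s * \<gamma>\<close>, so it maps the half-line \<open>s * z \<le> \<gamma>\<close>
  onto itself and the indicator keeps its form.\<close>

lemma distr_scad_limit_map: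
  assumes a: "a > 2" and s: "s \<in> {1, -1}"
  shows "distr std_normal_distribution borel (scad_limit_map a s \<gamma>) =
    density lborel (\<lambda>u. ennreal (scad_limit_density a s (ereal \<gamma>) u))"
proof (rule measure_eqI)
  fix A assume "A \<in> sets (distr std_normal_distribution borel (scad_limit_map a s \<gamma>))"
  then have [measurable]: "A \<in> sets borel" by simp
  \<comment> \<open>Slope and intercept of the inverse \<open>u \<mapsto> t + c * u\<close> of the
    affine branch.\<close>
  define c t where "c = (a - 2) / (a - 1)" and "t = s * \<gamma> / (a - 1)"
  have c: "c > 0" using a by (simp add: c_def)
  let ?g = "\<lambda>z. ennreal (std_normal_density z * indicator A (((a - 1) * z - s * \<gamma>) / (a - 2)) *
    indicator {z. s * z \<le> \<gamma>} z)"
  let ?h = "\<lambda>z. ennreal (std_normal_density z * indicator A z * indicator {z. \<gamma> < s * z} z)"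
  have eq: "t + c * u = ((a - 2) * u + s * \<gamma>) / (a - 1)" for u
    by (simp add: t_def c_def add_divide_distrib)
  have inv: "((a - 1) * (t + c * u) - s * \<gamma>) / (a - 2) = u" for u
    using a by (simp add: eq)
  have "s * (t + c * u) \<le> \<gamma> \<longleftrightarrow> s * u \<le> \<gamma>" for u
  proof -
    have "(a - 1) * (t + c * u) = (a - 2) * u + s * \<gamma>"
      using a by (simp add: eq)
    then have "(a - 1) * (s * (t + c * u)) = (a - 2) * (s * u) + \<gamma>"
      using s by (auto simp: algebra_simps)
    then have "(a - 1) * (s * (t + c * u)) \<le> (a - 1) * \<gamma> \<longleftrightarrow> (a - 2) * (s * u) \<le> (a - 2) * \<gamma>"
      by (simp only:) (simp add: algebra_simps)
    with a show ?thesis by simp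
  qed
  then have ind: "indicator {z. s * z \<le> \<gamma>} (t + c * u) = (indicator {z. s * z \<le> \<gamma>} u :: real)" for u
    by (simp add: indicator_def)
  have affine: "ennreal \<bar>c\<bar> * ?g (t + c * u) =
      ennreal (c * std_normal_density (((a - 2) * u + s * \<gamma>) / (a - 1)) * indicator {u. s * u \<le> \<gamma>} u * indicator A u)" for u
    unfolding inv ind using c by (simp add: eq ennreal_mult'[symmetric] mult_ac)
  have "emeasure (distr std_normal_distribution borel (scad_limit_map a s \<gamma>)) A =
      (\<integral>\<^sup>+z. ?g z + ?h z \<partial>lborel)"
    using measurable_sets_borel[OF scad_limit_map_measurable, of A a s \<gamma>]
    by (simp add: emeasure_distr emeasure_density)
      (auto intro!: nn_integral_cong simp: scad_limit_map_def indicator_def)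
  also have "\<dots> = (\<integral>\<^sup>+z. ?g z \<partial>lborel) + (\<integral>\<^sup>+z. ?h z \<partial>lborel)"
    by (rule nn_integral_add) auto
  \<comment> \<open>Substitution \<open>z = t + c * u\<close>, whose Jacobian \<open>c\<close> is
    the factor in front of the first term of the density.\<close>
  also have "(\<integral>\<^sup>+z. ?g z \<partial>lborel) = (\<integral>\<^sup>+u. ennreal \<bar>c\<bar> * ?g (t + c * u) \<partial>lborel)"
    using c by (subst nn_integral_real_affine[where c = c and t = t]) (auto simp: nn_integral_cmult)
  also have "\<dots> + (\<integral>\<^sup>+z. ?h z \<partial>lborel) = (\<integral>\<^sup>+u. ennreal \<bar>c\<bar> * ?g (t + c * u) + ?h u \<partial>lborel)"
    by (rule nn_integral_add[symmetric]) auto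
  also have "\<dots> = (\<integral>\<^sup>+u. ennreal (scad_limit_density a s (ereal \<gamma>) u) * indicator A u \<partial>lborel)"
    unfolding affine
    by (intro nn_integral_cong) (auto simp: scad_limit_density_def indicator_def c_def)
  also have "\<dots> = emeasure (density lborel (\<lambda>u. ennreal (scad_limit_density a s (ereal \<gamma>) u))) A"
    by (simp add: emeasure_density)
  finally show "emeasure (distr std_normal_distribution borel (scad_limit_map a s \<gamma>)) A =
    emeasure (density lborel (\<lambda>u. ennreal (scad_limit_density a s (ereal \<gamma>) u))) A" .
qed simp

text \<open>For finite \<open>r\<close> the density belongs to an image of the normal law, and for
  \<open>r = -\<infinity>\<close> it is the normal density itself.\<close>

lemma nn_integral_scad_limit_density:
  assumes "a > 2" "s \<in> {1, -1}" "r \<noteq> \<infinity>"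
  shows "(\<integral>\<^sup>+u. ennreal (scad_limit_density a s r u) \<partial>lborel) = 1"
proof (cases r)
  case (real \<gamma>)
  interpret N: prob_space std_normal_distribution
    by (rule prob_space_normal_density) simp
  have "prob_space (distr std_normal_distribution borel (scad_limit_map a s \<gamma>))"
    by (rule N.prob_space_distr) simp
  from prob_space.emeasure_space_1[OF this] show ?thesis
    unfolding distr_scad_limit_map[OF assms(1,2)] real by (simp add: emeasure_density)
next
  case MInf
  then show ?thesis
    using prob_space.emeasure_space_1[OF prob_space_normal_density[of 1 0]]
    by (simp add: scad_limit_density_MInfty emeasure_density)
qed (use assms in simp)

lemma prob_space_scad_limit_density:
  assumes "a > 2" "s \<in> {1, -1}" "r \<noteq> \<infinity>"
  shows "prob_space (density lborel (\<lambda>u. ennreal (scad_limit_density a s r u)))"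
  using nn_integral_scad_limit_density[OF assms] by (auto intro!: prob_spaceI simp: emeasure_density)

section \<open>Total variation convergence to the limiting density\<close>

text \<open>As the parameter varies, the indicators jump only when it passes \<open>s * u\<close>;
  away from there they are eventually constant and the rest is continuous.\<close>

lemma scad_limit_density_tendsto:
  assumes lim: "(\<lambda>n. ereal (\<gamma> n)) \<longlonglongrightarrow> r" and r: "r \<noteq> \<infinity>" "r \<noteq> ereal (s * u)"
  shows "(\<lambda>n. scad_limit_density a s (ereal (\<gamma> n)) u) \<longlonglongrightarrow> scad_limit_density a s r u"
proof (cases "r < ereal (s * u)")
  case True
  from order_tendstoD(2)[OF lim True]
  have "eventually (\<lambda>n. scad_limit_density a s (ereal (\<gamma> n)) u = scad_limit_density a s r u) sequentially"
    by eventually_elim (use True in \<open>auto simp: scad_limit_density_def\<close>)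
  then show ?thesis by (rule tendsto_eventually)
next
  case False
  with r have *: "ereal (s * u) < r" by auto
  with r obtain \<rho> where \<rho>: "r = ereal \<rho>" by (cases r) auto
  have \<gamma>: "\<gamma> \<longlonglongrightarrow> \<rho>" using lim \<rho> by simp
  let ?f = "\<lambda>\<gamma>. (a - 2) / (a - 1) * std_normal_density (((a - 2) * u + s * \<gamma>) / (a - 1))"
  from order_tendstoD(1)[OF lim *]
  have "eventually (\<lambda>n. ?f (\<gamma> n) = scad_limit_density a s (ereal (\<gamma> n)) u) sequentially"
    by eventually_elim (auto simp: scad_limit_density_def)
  moreover have "(\<lambda>n. ?f (\<gamma> n)) \<longlonglongrightarrow> ?f \<rho>"
  \<comment> \<open>At \<open>a = 1\<close> division by zero makes \<open>?f\<close> identically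
    0.\<close>
  proof (cases "a = 1")
    case False
    then show ?thesis
      unfolding std_normal_density_def by (intro tendsto_intros \<gamma>) auto
  qed simp
  moreover have "?f \<rho> = scad_limit_density a s r u"
    using * \<rho> by (simp add: scad_limit_density_def)
  ultimately show ?thesis
    by (simp add: tendsto_cong)
qed

text \<open>Pointwise convergence can fail only at the single point \<open>u = s * r\<close> when
  \<open>r\<close> is finite, and this is a null set.\<close>

lemma tv_dist_scad_limit_density_tendsto_0:
  assumes a: "a > 2" and s: "s \<in> {1, -1}"
    and lim: "(\<lambda>n. ereal (\<gamma> n)) \<longlonglongrightarrow> r" and r: "r \<noteq> \<infinity>"
  shows "(\<lambda>n. tv_dist (density lborel (\<lambda>u. ennreal (scad_limit_density a s (ereal (\<gamma> n)) u)))
    (density lborel (\<lambda>u. ennreal (scad_limit_density a s r u)))) \<longlonglongrightarrow> 0"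
proof (rule tv_dist_density_tendsto_0)
  have "AE u in lborel. r \<noteq> ereal (s * u)"
  proof (cases r)
    case (real \<rho>)
    have "AE u in lborel. u \<noteq> s * \<rho>" by (rule AE_lborel_singleton)
    then show ?thesis by eventually_elim (use s real in auto)
  qed auto
  then show "AE u in lborel. (\<lambda>n. scad_limit_density a s (ereal (\<gamma> n)) u) \<longlonglongrightarrow> scad_limit_density a s r u"
    by eventually_elim (rule scad_limit_density_tendsto[OF lim r])
qed (use nn_integral_scad_limit_density[OF a s] r scad_limit_density_nonneg[OF a] in auto)

text \<open>The law with parameter \<open>?\<gamma> n\<close> is inserted between the two. The first
  distance is bounded by the probability that \<open>?T n\<close> and \<open>?W n\<close> disagree,
  the second vanishes by convergence of the densities.\<close>

lemma tv_dist_scad_tendsto_0: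
  assumes a: "a > 2" and s: "s \<in> {1, -1}" and \<alpha>: "filterlim \<alpha> at_top sequentially"
    and lim: "(\<lambda>n. ereal (a * \<alpha> n - s * \<beta> n)) \<longlonglongrightarrow> r" and r: "r \<noteq> \<infinity>"
  shows "(\<lambda>n. tv_dist (distr std_normal_distribution borel (\<lambda>z. scad a (\<alpha> n) (z + \<beta> n) - \<beta> n))
    (density lborel (\<lambda>u. ennreal (scad_limit_density a s r u)))) \<longlonglongrightarrow> 0"
proof -
  interpret N: prob_space std_normal_distribution
    by (rule prob_space_normal_density) simp
  let ?\<gamma> = "\<lambda>n. a * \<alpha> n - s * \<beta> n"
  let ?T = "\<lambda>n z. scad a (\<alpha> n) (z + \<beta> n) - \<beta> n"
  let ?W = "\<lambda>n. scad_limit_map a s (?\<gamma> n)"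
  let ?N = std_normal_distribution
  let ?F = "\<lambda>r. density lborel (\<lambda>u. ennreal (scad_limit_density a s r u))"
  let ?D = "\<lambda>n. {z \<in> space ?N. ?T n z \<noteq> ?W n z}"
  \<comment> \<open>A finite eventual upper bound for \<open>?\<gamma> n\<close>, available because
    \<open>r\<close> is not \<open>\<infinity>\<close>.\<close>
  obtain C where C: "r < ereal C"
    using r by (cases r) (auto intro: that[of "real_of_ereal r + 1"] that[of 0])
  have ev: "eventually (\<lambda>n. ?T n z = ?W n z) sequentially" for z
  proof -
    have "filterlim (\<lambda>n. (a - 2) * \<alpha> n) at_top sequentially"
      using a by (intro filterlim_tendsto_pos_mult_at_top[OF tendsto_const _ \<alpha>]) auto
    then have "eventually (\<lambda>n. (a - 2) * \<alpha> n > C - s * z) sequentially"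
      by (simp add: filterlim_at_top_dense)
    moreover have "eventually (\<lambda>n. \<alpha> n > 0) sequentially"
      using \<alpha> by (simp add: filterlim_at_top_dense)
    moreover have "eventually (\<lambda>n. ?\<gamma> n < C) sequentially"
      using order_tendstoD(2)[OF lim C] by simp
    ultimately show ?thesis
    proof eventually_elim
      case (elim n)
      \<comment> \<open>The difference of the two sides is
        \<open>(a - 2) * \<alpha> n - ?\<gamma> n + s * z\<close>.\<close>
      then have "s * (z + \<beta> n) > 2 * \<alpha> n" by (simp add: algebra_simps)
      with elim show ?case by (intro scad_eq_scad_limit_map a s)
    qed
  qed
  have "(\<lambda>n. measure ?N (?D n)) \<longlonglongrightarrow> measure ?N {}"
    using ev by (intro N.tendsto_measure_pointwise) (auto elim: eventually_mono)
  moreover have "(\<lambda>n. tv_dist (?F (ereal (?\<gamma> n))) (?F r)) \<longlonglongrightarrow> 0"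
    by (rule tv_dist_scad_limit_density_tendsto_0[OF a s lim r])
  ultimately have bound: "(\<lambda>n. measure ?N (?D n) + tv_dist (?F (ereal (?\<gamma> n))) (?F r)) \<longlonglongrightarrow> 0"
    using tendsto_add by fastforce
  have prob: "prob_space (distr ?N borel (?T n))" "prob_space (?F (ereal (?\<gamma> n)))" "prob_space (?F r)" for n
    using prob_space_scad_limit_density[OF a s] r by (auto intro!: N.prob_space_distr)
  have "tv_dist (distr ?N borel (?T n)) (?F r) \<le> measure ?N (?D n) + tv_dist (?F (ereal (?\<gamma> n))) (?F r)" for n
    using tv_dist_triangle[OF prob(1)[of n] prob(2)[of n] prob(3)] N.tv_dist_distr_le[of "?T n" "?W n"]
    unfolding distr_scad_limit_map[OF a s] by force
  then show ?thesis
    by (intro tendsto_sandwich[OF _ _ tendsto_const[of 0] bound])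
       (auto intro!: always_eventually tv_dist_nonneg prob)
qed

section \<open>Escape of mass and convergence to pointmass\<close>

text \<open>By oddness only \<open>m = s * (z + \<beta>) > 0\<close> matters. Soft thresholding
  shrinks \<open>m\<close> by the minimum of \<open>m\<close> and \<open>\<alpha>\<close>, the
  middle branch by \<open>(a * \<alpha> - m) / (a - 2)\<close>; both are at least
  \<open>K\<close>.\<close>

lemma sgn_mult_scad_error_le:
  assumes "a > 2" "s \<in> {1, -1}" "K > 0"
    and "s * (z + \<beta>) \<ge> K" "\<alpha> \<ge> K" "a * \<alpha> - s * (z + \<beta>) \<ge> (a - 2) * K"
  shows "s * (scad a \<alpha> (z + \<beta>) - \<beta>) \<le> s * z - K"
proof -
  define m where "m = s * (z + \<beta>)"
  have m: "0 < m" "m \<ge> K" "a * \<alpha> - m \<ge> (a - 2) * K"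
    using assms unfolding m_def by linarith+
  have "(a - 2) * K > 0" using assms by simp
  \<comment> \<open>This excludes the identity branch, which does not shrink.\<close>
  with m have "m < a * \<alpha>" by linarith
  have "scad a \<alpha> m \<le> m - K"
  proof (cases "m \<le> 2 * \<alpha>")
    case True
    then show ?thesis using m assms by (auto simp: scad_def)
  next
    case False
    then have "scad a \<alpha> m = ((a - 1) * m - a * \<alpha>) / (a - 2)"
      using m \<open>m < a * \<alpha>\<close> by (simp add: scad_def)
    also have "\<dots> = m - (a * \<alpha> - m) / (a - 2)"
      using assms(1) by (simp add: field_simps)
    also have "\<dots> \<le> m - K"
      using m assms(1) by (simp add: pos_le_divide_eq mult.commute)
    finally show ?thesis .
  qed
  moreover have "scad a \<alpha> m = s * scad a \<alpha> (z + \<beta>)"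
    unfolding m_def by (rule scad_sgn_mult[OF assms(2)])
  ultimately show ?thesis
    by (simp add: m_def algebra_simps)
qed

text \<open>Since \<open>P\<close> does not depend on \<open>z\<close>, the limiting event is the
  whole line or empty.\<close>

lemma cdf_distr_tendsto:
  fixes T :: "nat \<Rightarrow> real \<Rightarrow> real"
  assumes [measurable]: "\<And>n. T n \<in> borel_measurable borel"
    and ev: "\<And>z. eventually (\<lambda>n. T n z \<le> x \<longleftrightarrow> P) sequentially"
  shows "(\<lambda>n. cdf (distr std_normal_distribution borel (T n)) x) \<longlonglongrightarrow> (if P then 1 else 0)"
proof -
  interpret N: prob_space std_normal_distribution
    by (rule prob_space_normal_density) simp
  have "(\<lambda>n. measure std_normal_distribution {z. T n z \<le> x}) \<longlonglongrightarrow>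
      measure std_normal_distribution (if P then UNIV else {})"
    using ev by (intro N.tendsto_measure_pointwise) auto
  then show ?thesis
    using N.prob_space by (auto simp: cdf_def measure_distr vimage_def)
qed

lemma scad_error_escapes:
  assumes a: "a > 2" and s: "s \<in> {1, -1}" and \<alpha>: "filterlim \<alpha> at_top sequentially"
    and \<beta>: "filterlim (\<lambda>n. s * \<beta> n) at_top sequentially"
    and \<gamma>: "filterlim (\<lambda>n. a * \<alpha> n - s * \<beta> n) at_top sequentially"
  shows "(\<lambda>n. cdf (distr std_normal_distribution borel (\<lambda>z. scad a (\<alpha> n) (z + \<beta> n) - \<beta> n)) x)
    \<longlonglongrightarrow> (if s = 1 then 1 else 0)"
proof (rule cdf_distr_tendsto)
  fix z
  \<comment> \<open>Chosen so that \<open>s * z - K < - \<bar>x\<bar>\<close>: the error then has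
    sign \<open>- s\<close> and modulus beyond that of \<open>x\<close>.\<close>
  define K where "K = \<bar>z\<bar> + \<bar>x\<bar> + 1"
  then have "K > 0" by simp
  have "eventually (\<lambda>n. s * \<beta> n \<ge> K - s * z) sequentially" "eventually (\<lambda>n. \<alpha> n \<ge> K) sequentially"
    "eventually (\<lambda>n. a * \<alpha> n - s * \<beta> n \<ge> (a - 2) * K + s * z) sequentially"
    using \<alpha> \<beta> \<gamma> by (auto simp: filterlim_at_top)
  then show "eventually (\<lambda>n. scad a (\<alpha> n) (z + \<beta> n) - \<beta> n \<le> x \<longleftrightarrow> s = 1) sequentially"
  proof eventually_elim
    case (elim n)
    then have "s * (scad a (\<alpha> n) (z + \<beta> n) - \<beta> n) \<le> s * z - K"
      using a s \<open>K > 0\<close> by (intro sgn_mult_scad_error_le) (auto simp: algebra_simps)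
    with s show ?case by (auto simp: K_def)
  qed
qed measurable

lemma scad_error_eq:
  assumes "a > 2" "\<bar>z + \<beta>\<bar> \<le> \<alpha>"
  shows "scad a \<alpha> (z + \<beta>) - \<beta> = - \<beta>"
  using assms by (auto simp: scad_def)

lemma tv_dist_tendsto_0_imp_cdf_tendsto:
  assumes "\<And>n. prob_space (M n)" "prob_space N" "\<And>n. sets (M n) = sets borel"
    and "(\<lambda>n. tv_dist (M n) N) \<longlonglongrightarrow> 0"
  shows "(\<lambda>n. cdf (M n) x) \<longlonglongrightarrow> cdf N x"
proof -
  have "(\<lambda>n. \<bar>cdf (M n) x - cdf N x\<bar>) \<longlonglongrightarrow> 0"
    unfolding cdf_def using assms
    by (intro tendsto_sandwich[OF _ _ tendsto_const[of 0] assms(4)])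
       (auto intro!: always_eventually abs_measure_diff_le_tv_dist)
  then show ?thesis
    by (simp add: LIM_zero_iff tendsto_rabs_zero_iff)
qed

text \<open>The minuend is finite, so no undefined difference of infinities arises even for infinite
  \<open>\<zeta>\<close>.\<close>

lemma tendsto_ereal_diff_mult:
  assumes "(\<lambda>n. ereal (x n)) \<longlonglongrightarrow> \<zeta>"
  shows "(\<lambda>n. ereal (a - s * x n)) \<longlonglongrightarrow> ereal a - ereal s * \<zeta>"
proof -
  have "(\<lambda>n. ereal s * ereal (x n)) \<longlonglongrightarrow> ereal s * \<zeta>"
    by (intro tendsto_cmult_ereal assms) simp
  then have "(\<lambda>n. ereal a - ereal s * ereal (x n)) \<longlonglongrightarrow> ereal a - ereal s * \<zeta>"
    by (intro tendsto_diff_ereal_general tendsto_const) auto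
  then show ?thesis by simp
qed

text \<open>Convergence to \<open>\<nu>\<close> is a premise of the later conjuncts only, because
  the first conjunct asserts convergence for nonzero \<open>\<zeta>\<close>.\<close>

theorem theorem11:
  fixes a :: real and \<eta> \<theta> :: "nat \<Rightarrow> real" and \<zeta> \<nu> :: ereal
  assumes "a > 2"
    and "\<And>n. n \<ge> 1 \<Longrightarrow> \<eta> n > 0"
    and "\<eta> \<longlonglongrightarrow> 0"
    and "filterlim (\<lambda>n. sqrt (real n) * \<eta> n) at_top sequentially"
    and "(\<lambda>n. ereal (\<theta> n / \<eta> n)) \<longlonglongrightarrow> \<zeta>"
  shows "(\<zeta> \<noteq> 0 \<longrightarrow> (\<lambda>n. ereal (sqrt (real n) * \<theta> n)) \<longlonglongrightarrow> sgn \<zeta> * \<infinity>) \<and>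
    ((\<lambda>n. ereal (sqrt (real n) * \<theta> n)) \<longlonglongrightarrow> \<nu> \<longrightarrow>
      (\<bar>\<zeta>\<bar> < ereal a \<or>
       \<bar>\<zeta>\<bar> = ereal a \<and>
         filterlim (\<lambda>n. sqrt (real n) * (a * \<eta> n - real_of_ereal (sgn \<zeta>) * \<theta> n)) at_top sequentially
       \<longrightarrow>
         (\<bar>\<nu>\<bar> < \<infinity> \<longrightarrow>
            weak_conv_m (\<lambda>n. scad_dist a (\<eta> n) n (\<theta> n)) (return borel (- real_of_ereal \<nu>))) \<and>
         (- \<nu> = \<infinity> \<longrightarrow> (\<forall>x. (\<lambda>n. cdf (scad_dist a (\<eta> n) n (\<theta> n)) x) \<longlonglongrightarrow> 0)) \<and>
         (- \<nu> = -\<infinity> \<longrightarrow> (\<forall>x. (\<lambda>n. cdf (scad_dist a (\<eta> n) n (\<theta> n)) x) \<longlonglongrightarrow> 1))) \<and>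
      (\<forall>r :: ereal.
         \<bar>\<zeta>\<bar> = ereal a \<and> r \<noteq> \<infinity> \<and>
         (\<lambda>n. ereal (sqrt (real n) * (a * \<eta> n - real_of_ereal (sgn \<zeta>) * \<theta> n))) \<longlonglongrightarrow> r
         \<longrightarrow>
         (\<forall>x. (\<lambda>n. cdf (scad_dist a (\<eta> n) n (\<theta> n)) x) \<longlonglongrightarrow>
            (LINT u:{..x}|lborel. scad_limit_density a (real_of_ereal (sgn \<zeta>)) r u)) \<and>
         (\<lambda>n. tv_dist (scad_dist a (\<eta> n) n (\<theta> n))
            (density lborel (\<lambda>u. ennreal (scad_limit_density a (real_of_ereal (sgn \<zeta>)) r u)))) \<longlonglongrightarrow> 0) \<and>
      (ereal a < \<bar>\<zeta>\<bar> \<longrightarrow>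
         weak_conv_m (\<lambda>n. scad_dist a (\<eta> n) n (\<theta> n)) std_normal_distribution \<and>
         (\<lambda>n. tv_dist (scad_dist a (\<eta> n) n (\<theta> n)) std_normal_distribution) \<longlonglongrightarrow> 0))"
proof -
  note a = assms(1) and \<eta>_pos = assms(2) and \<zeta> = assms(5)
  define \<alpha> \<beta> where "\<alpha> = (\<lambda>n. sqrt (real n) * \<eta> n)" and "\<beta> = (\<lambda>n. sqrt (real n) * \<theta> n)"
  define T where "T = (\<lambda>n z. scad a (\<alpha> n) (z + \<beta> n) - \<beta> n)"
  define s where "s = real_of_ereal (sgn \<zeta>)"
  let ?N = std_normal_distribution
  let ?M = "\<lambda>n. scad_dist a (\<eta> n) n (\<theta> n)"
  let ?F = "\<lambda>r. density lborel (\<lambda>u. ennreal (scad_limit_density a s r u))"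
  have \<alpha>: "filterlim \<alpha> at_top sequentially"
    using assms(4) by (simp add: \<alpha>_def)
  then have \<alpha>_ereal: "(\<lambda>n. ereal (\<alpha> n)) \<longlonglongrightarrow> \<infinity>"
    by (simp add: tendsto_PInfty_eq_at_top)
  \<comment> \<open>At \<open>n = 0\<close>, where \<open>\<eta>\<close> need not be positive, both
    sides are 0 because \<open>sqrt 0 = 0\<close>.\<close>
  have \<beta>_eq: "\<beta> n = \<alpha> n * (\<theta> n / \<eta> n)" for n
    using \<eta>_pos[of n] by (cases "n = 0") (auto simp: \<alpha>_def \<beta>_def)
  have \<gamma>_eq: "sqrt (real n) * (a * \<eta> n - t * \<theta> n) = a * \<alpha> n - t * \<beta> n" for n t
    by (simp add: \<alpha>_def \<beta>_def algebra_simps)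
  have \<beta>_lim: "(\<lambda>n. ereal (\<beta> n)) \<longlonglongrightarrow> sgn \<zeta> * \<infinity>" if "\<zeta> \<noteq> 0"
  proof -
    have "(\<lambda>n. ereal (\<alpha> n) * ereal (\<theta> n / \<eta> n)) \<longlonglongrightarrow> \<infinity> * \<zeta>"
      using that by (intro tendsto_mult_ereal \<alpha>_ereal \<zeta>) auto
    moreover have "\<infinity> * \<zeta> = sgn \<zeta> * \<infinity>"
      using that by (cases \<zeta>) (auto simp: sgn_if)
    ultimately show ?thesis by (simp add: \<beta>_eq)
  qed
  \<comment> \<open>The quantity is \<open>\<alpha> n\<close> times a factor with nonzero limit, so
    the product has no indeterminate form. For \<open>t = s\<close> and nonzero
    \<open>\<zeta>\<close>, the excluded case is exactly
    \<open>\<bar>\<zeta>\<bar> = a\<close>.\<close>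
  have \<gamma>_lim: "(\<lambda>n. ereal (a * \<alpha> n - t * \<beta> n)) \<longlonglongrightarrow> \<infinity> * (ereal a - ereal t * \<zeta>)"
    if "ereal a - ereal t * \<zeta> \<noteq> 0" for t
  proof -
    have "(\<lambda>n. ereal (\<alpha> n) * ereal (a - t * (\<theta> n / \<eta> n))) \<longlonglongrightarrow> \<infinity> * (ereal a - ereal t * \<zeta>)"
      using that by (intro tendsto_mult_ereal \<alpha>_ereal tendsto_ereal_diff_mult \<zeta>) auto
    moreover have "\<alpha> n * (a - t * (\<theta> n / \<eta> n)) = a * \<alpha> n - t * \<beta> n" for n
      by (simp add: \<beta>_eq algebra_simps)
    ultimately show ?thesis by (simp only: times_ereal.simps)
  qed
  have law: "?M n = distr ?N borel (T n)" if "n \<ge> 1" for n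
    using scad_dist_eq[OF that] by (simp add: T_def \<alpha>_def \<beta>_def)
  \<comment> \<open>The representation by \<open>T n\<close> holds from \<open>n = 1\<close> on, so
    limits are transferred through eventual equality.\<close>
  have law_lim: "(\<lambda>n. f (?M n)) \<longlonglongrightarrow> l" if "(\<lambda>n. f (distr ?N borel (T n))) \<longlonglongrightarrow> l"
    for f :: "real measure \<Rightarrow> real" and l
  proof (rule Lim_transform_eventually[OF that])
    show "eventually (\<lambda>n. f (distr ?N borel (T n)) = f (?M n)) sequentially"
      using eventually_ge_at_top[of "1 :: nat"] by eventually_elim (simp only: law)
  qed
  have [measurable]: "T n \<in> borel_measurable borel" for n
    unfolding T_def by measurable
  have prob: "prob_space (?M n)" "sets (?M n) = sets borel" for n
    using real_distribution_scad_dist[of a "\<eta> n" n "\<theta> n"]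
    by (auto simp: real_distribution_def real_distribution_axioms_def)

  \<comment> \<open>With \<open>\<beta>\<close> bounded and \<open>\<alpha>\<close> diverging, the
    estimator is eventually exactly zero at each \<open>z\<close>, leaving the error
    \<open>- \<beta> n\<close>.\<close>
  have finite: "weak_conv_m ?M (return borel (- real_of_ereal \<nu>))"
    if \<nu>: "(\<lambda>n. ereal (\<beta> n)) \<longlonglongrightarrow> \<nu>" "\<bar>\<nu>\<bar> < \<infinity>"
    unfolding weak_conv_m_def weak_conv_def
  proof (intro allI impI)
    fix x
    obtain b where b: "\<nu> = ereal b" using \<nu>(2) by (cases \<nu>) auto
    have \<beta>: "\<beta> \<longlonglongrightarrow> b" using \<nu>(1) b by simp
    interpret R: real_distribution "return borel (- b)"
      by (auto simp: real_distribution_def real_distribution_axioms_def intro: prob_space_return)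
    assume "isCont (cdf (return borel (- real_of_ereal \<nu>))) x"
    then have x: "x \<noteq> - b"
      by (auto simp: b R.isCont_cdf measure_return)
    have "eventually (\<lambda>n. T n z \<le> x \<longleftrightarrow> - b \<le> x) sequentially" for z
    proof -
      have "eventually (\<lambda>n. \<alpha> n \<ge> \<bar>z\<bar> + \<bar>b\<bar> + 1) sequentially"
        using \<alpha> by (auto simp: filterlim_at_top)
      \<comment> \<open>The bound 1 keeps \<open>z + \<beta> n\<close> within the threshold; the
        bound \<open>\<bar>x + b\<bar>\<close> keeps \<open>- \<beta> n\<close> on the same side of
        \<open>x\<close> as \<open>- b\<close>.\<close>
      moreover have "eventually (\<lambda>n. dist (\<beta> n) b < min 1 \<bar>x + b\<bar>) sequentially"
        using x by (intro tendstoD[OF \<beta>]) auto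
      ultimately show ?thesis
      proof eventually_elim
        case (elim n)
        then have "T n z = - \<beta> n"
          unfolding T_def by (intro scad_error_eq a) (auto simp: dist_real_def)
        with elim show ?case by (auto simp: dist_real_def)
      qed
    qed
    then have "(\<lambda>n. cdf (?M n) x) \<longlonglongrightarrow> (if - b \<le> x then 1 else 0)"
      by (intro law_lim[where f = "\<lambda>M. cdf M x"] cdf_distr_tendsto) auto
    moreover have "cdf (return borel (- real_of_ereal \<nu>)) x = (if - b \<le> x then 1 else 0)"
      by (simp add: cdf_def b measure_return)
    ultimately show "(\<lambda>n. cdf (?M n) x) \<longlonglongrightarrow> cdf (return borel (- real_of_ereal \<nu>)) x"
      by simp
  qed

  \<comment> \<open>Here \<open>t\<close> is the sign of the infinite limit of
    \<open>\<beta>\<close>. It is kept apart from \<open>s\<close>, which is 0 when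
    \<open>\<zeta> = 0\<close> although \<open>\<beta>\<close> may diverge in either
    direction.\<close>
  have escape: "(\<lambda>n. cdf (?M n) x) \<longlonglongrightarrow> (if t = 1 then 1 else 0)"
    if \<nu>: "(\<lambda>n. ereal (\<beta> n)) \<longlonglongrightarrow> ereal t * \<infinity>" and t: "t \<in> {1, -1}"
      and cond: "\<bar>\<zeta>\<bar> < ereal a \<or> \<bar>\<zeta>\<bar> = ereal a \<and> filterlim (\<lambda>n. a * \<alpha> n - s * \<beta> n) at_top sequentially"
    for t x
  proof -
    have "(\<lambda>n. ereal t * ereal (\<beta> n)) \<longlonglongrightarrow> ereal t * (ereal t * \<infinity>)"
      by (intro tendsto_cmult_ereal \<nu>) simp
    then have \<beta>: "filterlim (\<lambda>n. t * \<beta> n) at_top sequentially"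
      using t by (auto simp: tendsto_PInfty_eq_at_top)
    have "filterlim (\<lambda>n. a * \<alpha> n - t * \<beta> n) at_top sequentially"
      using cond
    proof
      assume "\<bar>\<zeta>\<bar> < ereal a"
      then have "ereal a - ereal t * \<zeta> > 0"
        using t by (cases \<zeta>) auto
      then show ?thesis
        using \<gamma>_lim[of t] by (auto simp: tendsto_PInfty_eq_at_top)
    next
      assume *: "\<bar>\<zeta>\<bar> = ereal a \<and> filterlim (\<lambda>n. a * \<alpha> n - s * \<beta> n) at_top sequentially"
      then have "\<zeta> \<noteq> 0" using a by auto
      \<comment> \<open>On the boundary \<open>\<zeta>\<close> is nonzero and determines the limit
        of \<open>\<beta>\<close>, so the two signs agree.\<close>
      from LIMSEQ_unique[OF \<nu> \<beta>_lim[OF this]] have "t = s"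
        using t * a by (cases \<zeta>) (auto simp: s_def sgn_if split: if_splits)
      with * show ?thesis by simp
    qed
    from scad_error_escapes[OF a t \<alpha> \<beta> this] show ?thesis
      by (intro law_lim[where f = "\<lambda>M. cdf M x"]) (simp add: T_def)
  qed

  have tv: "(\<lambda>n. tv_dist (?M n) (?F r)) \<longlonglongrightarrow> 0 \<and>
      (\<forall>x. (\<lambda>n. cdf (?M n) x) \<longlonglongrightarrow> (LINT u:{..x}|lborel. scad_limit_density a s r u))"
    if r: "(\<lambda>n. ereal (a * \<alpha> n - s * \<beta> n)) \<longlonglongrightarrow> r" "r \<noteq> \<infinity>" and "\<zeta> \<noteq> 0" for r
  proof -
    have s: "s \<in> {1, -1}"
      using \<open>\<zeta> \<noteq> 0\<close> by (cases \<zeta>) (auto simp: s_def sgn_if)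
    have tv: "(\<lambda>n. tv_dist (?M n) (?F r)) \<longlonglongrightarrow> 0"
      using tv_dist_scad_tendsto_0[OF a s \<alpha> r]
      by (intro law_lim[where f = "\<lambda>M. tv_dist M (?F r)"]) (simp add: T_def)
    have "integrable lborel (scad_limit_density a s r)"
      using nn_integral_scad_limit_density[OF a s r(2)] scad_limit_density_nonneg[OF a]
      by (auto simp: integrable_iff_bounded)
    then have "cdf (?F r) x = (LINT u:{..x}|lborel. scad_limit_density a s r u)" for x
      unfolding cdf_def using scad_limit_density_nonneg[OF a]
      by (intro measure_density_eq_integral) auto
    with tv tv_dist_tendsto_0_imp_cdf_tendsto[OF prob(1) prob_space_scad_limit_density[OF a s r(2)] prob(2) tv]
    show ?thesis by simp
  qed

  have normal: "weak_conv_m ?M ?N \<and> (\<lambda>n. tv_dist (?M n) ?N) \<longlonglongrightarrow> 0" if "ereal a < \<bar>\<zeta>\<bar>"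
  proof -
    have "\<zeta> \<noteq> 0" using that a by auto
    moreover have "ereal a - ereal s * \<zeta> < 0"
      using that a by (cases \<zeta>) (auto simp: s_def sgn_if)
    then have "ereal a - ereal s * \<zeta> \<noteq> 0" "\<not> 0 < ereal a - ereal s * \<zeta>"
      by (auto dest: less_asym)
    \<comment> \<open>Here \<open>s * \<zeta> = \<bar>\<zeta>\<bar> > a\<close>, so the limiting
      factor is negative and \<open>r = -\<infinity>\<close> applies.\<close>
    then have "(\<lambda>n. ereal (a * \<alpha> n - s * \<beta> n)) \<longlonglongrightarrow> -\<infinity>"
      using \<gamma>_lim[of s] by simp
    ultimately have tv_N: "(\<lambda>n. tv_dist (?M n) ?N) \<longlonglongrightarrow> 0"
      using tv[of "-\<infinity>"] by (simp add: scad_limit_density_MInfty)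
    then show ?thesis
      unfolding weak_conv_m_def weak_conv_def
      using tv_dist_tendsto_0_imp_cdf_tendsto[OF prob(1) prob_space_normal_density[of 1 0] prob(2)]
      by auto
  qed

  have nonzero: "\<zeta> \<noteq> 0" if "\<bar>\<zeta>\<bar> = ereal a" using that a by auto
  have "\<nu> = ereal (-1) * \<infinity>" if "- \<nu> = \<infinity>" using that by (cases \<nu>) auto
  moreover have "\<nu> = ereal 1 * \<infinity>" if "- \<nu> = -\<infinity>" using that by (cases \<nu>) auto
  moreover have \<beta>_fold: "(\<lambda>n. ereal (sqrt (real n) * \<theta> n)) = (\<lambda>n. ereal (\<beta> n))"
    by (simp add: \<beta>_def)
  ultimately show ?thesis
    unfolding \<gamma>_eq s_def[symmetric] \<beta>_fold
  \<comment> \<open>Goal 1 is the limit of \<open>\<beta>\<close>; goals 2 to 4 treat finite,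
    negative infinite and positive infinite \<open>\<nu>\<close>; goals 5 and 6 are the boundary
    case; goals 7 and 8 are the normal limit.\<close>
  proof (intro conjI impI allI, goal_cases)
    case 1 then show ?case using \<beta>_lim by blast
  next
    case 2 then show ?case by (intro finite) auto
  next
    case (3 x) then show ?case using escape[of "-1" x] by simp
  next
    case (4 x) then show ?case using escape[of 1 x] by simp
  next
    case (5 r x) then show ?case using tv[of r] nonzero by blast
  next
    case (6 r) then show ?case using tv[of r] nonzero by blast
  next
    case 7 then show ?case using normal by blast
  next
    case 8 then show ?case using normal by blast
  qed
qed

end
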